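(* Let $q\ne[0,0,0]$ be an integral binary quadratic form of square discriminant $D=m^2$ ($m\ge0$). The form $q_2$ produced from $q$ by the reduction algorithm described in the context is reduced (so every form of square discriminant is explicitly equivalent to a reduced form), and two such forms are equivalent if and only if the reduced forms produced from them are equal.
   Context: Forms $[a,b,c]=ax^2+bxy+cy^2$ have integer coefficients and discriminant $D=b^2-4ac$. For $M=\begin{pmatrix}\alpha&\beta\\\gamma&\delta\end{pmatrix}$, $q|M(x,y):=q(\alpha x+\beta y,\gamma x+\delta y)$; $q_1\sim q_2$ if $q_1=q_2|M$ for some $M\in\mathrm{SL}(2,\mathbb{Z})$. $L=\begin{pmatrix}1&1\\0&1\end{pmatrix}$, $R=\begin{pmatrix}1&0\\1&1\end{pmatrix}$. A form of discriminant $m^2>0$ is reduced if it equals $[0,m,c]$ with $0<c\le m$; the reduced forms of discriminant $0$ are the $[0,0,c]$. Roots: for $q=[a,b,c]$ with $a\ne0$, $\zeta_q=\frac{-b+\sqrt D}{2a}$, $\zeta'_q=\frac{-b-\sqrt D}{2a}$. For $a=0$ and $q\ne[0,0,0]$: if $b\le0$ then $\zeta_q=\infty$, $\zeta'_q=-c/b$; if $b\ge0$ then $\zeta_q=-c/b$, $\zeta'_q=\infty$ (with $1/0=\infty$). Matrix associated with a rational root $x$: if $x\in\{0,\infty\}$ it is $I$; otherwise write $x=\langle a_0,a_1,\dots,a_n\rangle$ (finite continued fraction, $a_0\in\mathbb Z$, $a_i\ge1$ for $i\ge1$) and take $L^{a_0}R^{a_1}L^{a_2}\cdots$ with factors up to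 exponent $a_n$ (ending in $L^{a_n}$ if $n$ even, $R^{a_n}$ if $n$ odd). Reduction algorithm: let $M_1$ be the matrix associated with $\zeta_q$ using its standard continued fraction expansion, and $q_1=q|M_1$. Let $M_2$ be the matrix associated with $\zeta'_{q_1}$, using the continued fraction representation of $\zeta'_{q_1}$ with $n$ odd (every rational has exactly one such representation), and $q_2=q_1|M_2$. If $q_2=[0,m,0]$, replace $M_2$ by $M_2L$, so that $q_2=[0,m,m]$. Output $q_2$ and $M=M_1M_2$.
   Formalization: The algorithm as described sends [1,2,0] to [0,2,3], not reduced. It is corrected: an output [0,m,c] with c>m>0 (exactly when q_1=[a,m,0], a>0, a|m, m>0) gets a further factor L^{-1}; and in the second step the root 0 is given the matrix L^{-1}R of <-1,1> instead of I. *)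

theory Defs
  imports "HOL-Analysis.Analysis"
begin

section \<open>Integral binary quadratic forms\<close>

text \<open>\<open>Form a b c\<close> is $[a,b,c] = ax^2 + bxy + cy^2$.\<close>

datatype form = Form (coeff_a: int) (coeff_b: int) (coeff_c: int)

definition form_eval :: "form \<Rightarrow> int \<Rightarrow> int \<Rightarrow> int" where
  "form_eval q x y = coeff_a q * x\<^sup>2 + coeff_b q * x * y + coeff_c q * y\<^sup>2"

definition disc :: "form \<Rightarrow> int" where
  "disc q = (coeff_b q)\<^sup>2 - 4 * coeff_a q * coeff_c q"

type_synonym mat2 = "int ^ 2 ^ 2"

abbreviation mat2 :: "int \<Rightarrow> int \<Rightarrow> int \<Rightarrow> int \<Rightarrow> mat2" where
  "mat2 \<alpha> \<beta> \<gamma> \<delta> \<equiv> vector [vector [\<alpha>, \<beta>], vector [\<gamma>, \<delta>]]"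

text \<open>The coefficients of \<open>q|M\<close>; the defining substitution is \<open>form_eval_act\<close> below.\<close>

definition act :: "form \<Rightarrow> mat2 \<Rightarrow> form" where
  "act q M =
    (let \<alpha> = M $ 1 $ 1; \<beta> = M $ 1 $ 2; \<gamma> = M $ 2 $ 1; \<delta> = M $ 2 $ 2;
         a = coeff_a q; b = coeff_b q; c = coeff_c q
     in Form (a * \<alpha>\<^sup>2 + b * \<alpha> * \<gamma> + c * \<gamma>\<^sup>2)
             (2 * a * \<alpha> * \<beta> + b * (\<alpha> * \<delta> + \<beta> * \<gamma>) + 2 * c * \<gamma> * \<delta>)
             (a * \<beta>\<^sup>2 + b * \<beta> * \<delta> + c * \<delta>\<^sup>2))"

lemma form_eval_act:
  "form_eval (act q M) x y =
    form_eval q (M $ 1 $ 1 * x + M $ 1 $ 2 * y) (M $ 2 $ 1 * x + M $ 2 $ 2 * y)"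
  by (simp add: act_def form_eval_def Let_def power2_eq_square algebra_simps)

definition equivalent :: "form \<Rightarrow> form \<Rightarrow> bool" where
  "equivalent q1 q2 \<longleftrightarrow> (\<exists>M :: mat2. det M = 1 \<and> q1 = act q2 M)"

definition reduced :: "form \<Rightarrow> bool" where
  "reduced q \<longleftrightarrow>
    (\<exists>m c. 0 < m \<and> disc q = m\<^sup>2 \<and> q = Form 0 m c \<and> 0 < c \<and> c \<le> m) \<or>
    (disc q = 0 \<and> (\<exists>c. q = Form 0 0 c))"


section \<open>Roots\<close>

datatype point = Point real | Infty

definition neg_quotient :: "int \<Rightarrow> int \<Rightarrow> point" where
  "neg_quotient c b = (if b = 0 then Infty else Point (- of_int c / of_int b))"

text \<open>Only meaningful for nonzero forms of nonnegative discriminant.\<close>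

definition root1 :: "form \<Rightarrow> point" where
  "root1 q =
    (let a = coeff_a q; b = coeff_b q; c = coeff_c q
     in if a \<noteq> 0 then Point ((- of_int b + sqrt (of_int (disc q))) / (2 * of_int a))
        else if b \<le> 0 then Infty else neg_quotient c b)"

definition root2 :: "form \<Rightarrow> point" where
  "root2 q =
    (let a = coeff_a q; b = coeff_b q; c = coeff_c q
     in if a \<noteq> 0 then Point ((- of_int b - sqrt (of_int (disc q))) / (2 * of_int a))
        else if b \<le> 0 then neg_quotient c b else Infty)"


section \<open>Continued fractions and the associated matrices\<close>

fun cf_value :: "int list \<Rightarrow> real" where
  "cf_value [] = 0"
| "cf_value [a] = of_int a"
| "cf_value (a # as) = of_int a + 1 / cf_value as"

definition is_cf :: "int list \<Rightarrow> real \<Rightarrow> bool" where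
  "is_cf as x \<longleftrightarrow> as \<noteq> [] \<and> (\<forall>a \<in> set (tl as). 1 \<le> a) \<and> cf_value as = x"

text \<open>
  The standard expansion of a rational is the one delivered by the Euclidean algorithm: its last
  partial quotient is at least 2, unless it is the only one.
\<close>

definition standard_cf :: "real \<Rightarrow> int list" where
  "standard_cf x = (THE as. is_cf as x \<and> (length as = 1 \<or> 2 \<le> last as))"

text \<open>The expansion $\langle a_0,\dots,a_n\rangle$ with \<open>n\<close> odd has an even number of entries.\<close>

definition odd_cf :: "real \<Rightarrow> int list" where
  "odd_cf x = (THE as. is_cf as x \<and> even (length as))"

definition mat_L :: mat2 where "mat_L = mat2 1 1 0 1"

definition mat_R :: mat2 where "mat_R = mat2 1 0 1 1"

text \<open>Integer powers of a matrix; the operator \<open>^\<close> on \<^typ>\<open>mat2\<close> acts entrywise.\<close>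

definition mat_zpow :: "mat2 \<Rightarrow> int \<Rightarrow> mat2" where
  "mat_zpow M k =
    (if 0 \<le> k then (((**) M) ^^ nat k) (mat 1)
     else (((**) (matrix_inv M)) ^^ nat (- k)) (mat 1))"

fun alternating_prod :: "mat2 \<Rightarrow> mat2 \<Rightarrow> int list \<Rightarrow> mat2" where
  "alternating_prod X Y [] = mat 1"
| "alternating_prod X Y (a # as) = mat_zpow X a ** alternating_prod Y X as"

text \<open>
  The matrix associated with a root, with respect to a choice \<open>cf\<close> of a continued fraction for
  every rational number. For the standard expansion $0 = \langle 0\rangle$ it is $L^0 = I$, in
  agreement with the convention that \<open>0\<close> and $\infty$ get the identity. For the expansion with
  \<open>n\<close> odd, which also \<open>0\<close> has, namely $0 = \langle -1, 1\rangle$, it is $L^{-1}R$. The second step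
  of the algorithm needs this latter matrix, because it must move the second root to $\infty$: with
  the identity, $[0,-m,0]$ and $[a,0,0]$ would remain unreduced.
\<close>

definition associated_matrix :: "(real \<Rightarrow> int list) \<Rightarrow> point \<Rightarrow> mat2" where
  "associated_matrix cf p =
    (case p of Infty \<Rightarrow> mat 1 | Point x \<Rightarrow> alternating_prod mat_L mat_R (cf x))"


section \<open>The reduction algorithm\<close>

definition step1_matrix :: "form \<Rightarrow> mat2" where
  "step1_matrix q = associated_matrix standard_cf (root1 q)"

definition step1 :: "form \<Rightarrow> form" where
  "step1 q = act q (step1_matrix q)"

definition step2_matrix :: "form \<Rightarrow> mat2" where
  "step2_matrix q1 =
    (let M2 = associated_matrix odd_cf (root2 q1)
     in if \<exists>m \<ge> 0. act q1 M2 = Form 0 m 0 then M2 ** mat_L else M2)"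

definition basic_reduction :: "form \<Rightarrow> form \<times> mat2" where
  "basic_reduction q =
    (let M1 = step1_matrix q; q1 = step1 q; M2 = step2_matrix q1
     in (act q1 M2, M1 ** M2))"

text \<open>
  In one case the output of \<open>basic_reduction\<close> fails to be reduced. If $q_1 = [a,m,0]$ with
  $a > 0$ and \<open>a\<close> dividing \<open>m\<close>, then the second root of $q_1$ is the negative integer $-m/a$,
  whose expansion with \<open>n\<close> odd is $\langle -m/a-1, 1\rangle$, and the output is $[0,m,m+a]$; for
  instance, $[1,2,0]$ becomes $[0,2,3]$ (\<open>basic_reduction_counterexample\<close> below). Just as the
  output $[0,m,0]$ is corrected by a factor \<open>L\<close>, this output has to be corrected by a factor
  $L^{-1}$, which gives $[0,m,a]$.
\<close>

definition reduction :: "form \<Rightarrow> form \<times> mat2" where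
  "reduction q =
    (let (q2, M) = basic_reduction q
     in if \<exists>m c. 0 < m \<and> m < c \<and> q2 = Form 0 m c
        then (act q2 (mat_zpow mat_L (- 1)), M ** mat_zpow mat_L (- 1))
        else (q2, M))"

abbreviation reduction_form :: "form \<Rightarrow> form" where
  "reduction_form q \<equiv> fst (reduction q)"

abbreviation reduction_matrix :: "form \<Rightarrow> mat2" where
  "reduction_matrix q \<equiv> snd (reduction q)"

definition exceptional :: "form \<Rightarrow> bool" where
  "exceptional q \<longleftrightarrow> (\<exists>a m. 0 < a \<and> 0 < m \<and> a dvd m \<and> step1 q = Form a m 0)"


subsection \<open>The correction is necessary\<close>

lemma cf_value_Cons: "as \<noteq> [] \<Longrightarrow> cf_value (a # as) = of_int a + 1 / cf_value as"
  by (cases as) auto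

lemma cf_value_ge_1:
  assumes "as \<noteq> []" "\<forall>a \<in> set as. 1 \<le> a"
  shows "1 \<le> cf_value as" and "cf_value as = 1 \<Longrightarrow> as = [1]"
proof -
  have "1 \<le> cf_value as \<and> (cf_value as = 1 \<longrightarrow> as = [1])"
    using assms
  proof (induction as)
    case (Cons a as)
    show ?case
    proof (cases "as = []")
      case False
      then have "0 < 1 / cf_value as" using Cons by auto
      moreover have "1 \<le> real_of_int a" using Cons.prems by simp
      ultimately have "1 < of_int a + 1 / cf_value as" by linarith
      then show ?thesis using False by (simp add: cf_value_Cons)
    qed (use Cons.prems in auto)
  qed simp
  then show "1 \<le> cf_value as" and "cf_value as = 1 \<Longrightarrow> as = [1]" by auto
qed

lemma is_cf_int:
  assumes "is_cf as (of_int k)"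
  shows "as = [k] \<or> as = [k - 1, 1]"
proof -
  obtain a bs where as: "as = a # bs" using assms by (cases as) (auto simp: is_cf_def)
  show ?thesis
  proof (cases "bs = []")
    case True
    then show ?thesis using assms by (simp add: as is_cf_def)
  next
    case False
    have ge: "\<forall>b \<in> set bs. 1 \<le> b" using assms by (simp add: as is_cf_def)
    have 1: "1 \<le> cf_value bs" by (rule cf_value_ge_1(1)[OF False ge])
    have eq: "1 / cf_value bs = of_int (k - a)"
      using assms False by (simp add: as is_cf_def cf_value_Cons)
    have pos: "0 < 1 / cf_value bs" and le: "1 / cf_value bs \<le> 1" using 1 by auto
    have "k - a = 1" using pos le unfolding eq by linarith
    then have "cf_value bs = 1" using eq 1 by (simp add: field_simps)
    then show ?thesis using cf_value_ge_1(2)[OF False ge] \<open>k - a = 1\<close> by (simp add: as)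
  qed
qed

lemma standard_cf_int: "standard_cf (of_int k) = [k]"
  unfolding standard_cf_def
proof (rule the_equality)
  show "is_cf [k] (of_int k) \<and> (length [k] = 1 \<or> 2 \<le> last [k])"
    by (simp add: is_cf_def)
qed (auto dest: is_cf_int)

lemma odd_cf_int: "odd_cf (of_int k) = [k - 1, 1]"
  unfolding odd_cf_def
proof (rule the_equality)
  show "is_cf [k - 1, 1] (of_int k) \<and> even (length [k - 1, 1])"
    by (simp add: is_cf_def)
qed (auto dest: is_cf_int)

lemma mat2_mult:
  "mat2 a b c d ** mat2 a' b' c' d' =
    mat2 (a * a' + b * c') (a * b' + b * d') (c * a' + d * c') (c * b' + d * d')"
  by (simp add: vec_eq_iff forall_2 matrix_matrix_mult_def sum_2)

lemma mat_1_eq: "(mat 1 :: mat2) = mat2 1 0 0 1"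
  by (simp add: vec_eq_iff forall_2 mat_def)

lemma matrix_inv_L: "matrix_inv mat_L = mat2 1 (- 1) 0 1"
proof -
  let ?N = "mat2 1 (- 1) 0 1"
  have N: "mat_L ** ?N = mat 1" "?N ** mat_L = mat 1"
    by (simp_all add: mat_L_def mat2_mult mat_1_eq)
  have "mat_L ** matrix_inv mat_L = mat 1 \<and> matrix_inv mat_L ** mat_L = mat 1"
    unfolding matrix_inv_def by (rule someI[of _ ?N]) (use N in blast)
  then have "?N = (?N ** mat_L) ** matrix_inv mat_L"
    by (metis matrix_mul_assoc matrix_mul_rid)
  then show ?thesis by (simp only: N(2) matrix_mul_lid)
qed

lemma mat_zpow_L: "mat_zpow mat_L k = mat2 1 k 0 1"
proof -
  have 1: "(((**) mat_L) ^^ n) (mat 1) = mat2 1 (int n) 0 1" for n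
    by (induction n) (simp_all add: mat_1_eq mat_L_def mat2_mult add.commute)
  have 2: "(((**) (matrix_inv mat_L)) ^^ n) (mat 1) = mat2 1 (- int n) 0 1" for n
    by (induction n) (simp_all add: mat_1_eq matrix_inv_L mat2_mult algebra_simps)
  show ?thesis by (simp add: mat_zpow_def 1 2)
qed

lemma basic_reduction_counterexample:
  "disc (Form 1 2 0) = 2\<^sup>2"
  "fst (basic_reduction (Form 1 2 0)) = Form 0 2 3"
  "\<not> reduced (Form 0 2 3)"
proof -
  have sqrt4: "sqrt (4 :: real) = 2" by (rule real_sqrt_unique) auto
  have r1: "root1 (Form 1 2 0) = Point (of_int 0)"
    and r2: "root2 (Form 1 2 0) = Point (of_int (- 2))"
    by (simp_all add: root1_def root2_def disc_def sqrt4)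
  have R: "mat_zpow mat_R 1 = mat2 1 0 1 1"
    by (simp add: mat_zpow_def mat_R_def mat_1_eq mat2_mult)
  have M1: "step1_matrix (Form 1 2 0) = mat2 1 0 0 1"
    unfolding step1_matrix_def r1 associated_matrix_def
    by (simp del: of_int_0 add: standard_cf_int mat_zpow_L mat_1_eq mat2_mult)
  have M2: "associated_matrix odd_cf (root2 (Form 1 2 0)) = mat2 (- 2) (- 3) 1 1"
    unfolding r2 associated_matrix_def
    by (simp del: of_int_minus of_int_numeral
        add: odd_cf_int mat_zpow_L R mat_1_eq mat2_mult)
  have q1: "step1 (Form 1 2 0) = Form 1 2 0"
    by (simp add: step1_def M1 act_def)
  show "disc (Form 1 2 0) = 2\<^sup>2" by (simp add: disc_def)
  show "fst (basic_reduction (Form 1 2 0)) = Form 0 2 3"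
    by (simp add: basic_reduction_def Let_def q1 step2_matrix_def M2) (simp add: act_def)
  show "\<not> reduced (Form 0 2 3)" by (auto simp: reduced_def disc_def)
qed

end

theory Submission
  imports Defs
begin

text \<open>
  The matrix of a continued fraction of \<open>x\<close> with \<open>n\<close> odd (resp. even) has the last convergent
  \<open>x = p / r\<close> as its first (resp. second) column, and the preceding convergent \<open>p' / r'\<close> as the
  other one. Hence the first step moves the first root to \<open>0\<close> or \<open>\<infinity>\<close>, giving
  $[0,-m,k]$ or $[k,m,0]$, and the second step moves the second root to \<open>\<infinity>\<close>, giving
  $[0,m,c]$. For \<open>m > 0\<close> one finds $c = m r'/r$ in the first case and, if $k \<noteq> 0$, $c = m p'/p$
  in the second, so that monotonicity of numerators and denominators bounds \<open>c\<close>. For negative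
  \<open>x\<close> it fails only if \<open>r = r' = 1\<close>, which is the exceptional case. Finally, a matrix
  of determinant 1 relating $[0,m,c]$ and $[0,m,c']$ with \<open>m > 0\<close> must be upper triangular, so
  \<open>c\<close> and \<open>c'\<close> are congruent modulo \<open>m\<close>.
\<close>

section \<open>Continued fractions of rational numbers\<close>

lemma is_cf_Cons_iff:
  assumes "as \<noteq> []"
  shows "is_cf (a # as) x \<longleftrightarrow>
    (\<forall>b \<in> set as. 1 \<le> b) \<and> is_cf as (cf_value as) \<and> x = of_int a + 1 / cf_value as"
  using assms by (auto simp: is_cf_def cf_value_Cons dest: list.set_sel(2))

text \<open>Once the tails \<open>[]\<close> and \<open>[1]\<close> are excluded, the tail has value
  greater than 1, so its reciprocal is a fractional part strictly between 0 and 1. This pins down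
  the first term.\<close>

lemma is_cf_Cons_floor:
  assumes "is_cf (a # as) x" "as \<noteq> []" "as \<noteq> [1]"
  shows "1 < cf_value as" "\<lfloor>x\<rfloor> = a" "x \<notin> \<int>"
proof -
  have "1 \<le> cf_value as" "cf_value as \<noteq> 1"
    using cf_value_ge_1[of as] assms by (auto simp: is_cf_Cons_iff)
  then show v: "1 < cf_value as" by simp
  have x: "x = of_int a + 1 / cf_value as" using assms by (simp add: is_cf_Cons_iff)
  have "0 < 1 / cf_value as" "1 / cf_value as < 1" using v by (simp_all add: field_simps)
  then show fl: "\<lfloor>x\<rfloor> = a" using x by linarith
  show "x \<notin> \<int>"
    using fl x \<open>0 < 1 / cf_value as\<close> by (metis Ints_cases add_cancel_left_right floor_of_int less_irrefl)
qed

text \<open>The disjunctive hypothesis serves both normalizations, by parity of the length and by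
  the last term. An integer has only the expansions \<open>[k]\<close> and
  \<open>[k - 1, 1]\<close>, which differ in both respects; otherwise the floor determines the head,
  and the tails have equal values.\<close>

lemma is_cf_unique:
  assumes "is_cf as x" "is_cf bs x"
    and "even (length as) = even (length bs) \<or>
      (length as = 1 \<or> 2 \<le> last as) = (length bs = 1 \<or> 2 \<le> last bs)"
  shows "as = bs"
  using assms
proof (induction as arbitrary: bs x)
  case Nil
  then show ?case by (simp add: is_cf_def)
next
  case (Cons a as)
  show ?case
  proof (cases "x \<in> \<int>")
    case True
    then obtain k where "x = of_int k" by (auto elim: Ints_cases)
    then show ?thesis
      using is_cf_int[of "a # as" k] is_cf_int[of bs k] Cons.prems by auto
  next
    case False
    have nonint: "cs \<noteq> [] \<and> cs \<noteq> [1]" if "is_cf (c # cs) x" for c cs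
      using that False by (auto simp: is_cf_def)
    obtain b bs' where bs: "bs = b # bs'"
      using Cons.prems(2) by (cases bs) (auto simp: is_cf_def)
    have as': "as \<noteq> []" "as \<noteq> [1]" and bs': "bs' \<noteq> []" "bs' \<noteq> [1]"
      using nonint Cons.prems(1,2) bs by auto
    note A = is_cf_Cons_floor[OF Cons.prems(1) as']
    note B = is_cf_Cons_floor[OF Cons.prems(2)[unfolded bs] bs']
    have "1 / cf_value as = 1 / cf_value bs'"
      using A(2) B(2) Cons.prems(1,2) as' bs' bs by (simp add: is_cf_Cons_iff)
    then have eq: "cf_value as = cf_value bs'" by simp
    \<comment> \<open>A one-term tail other than \<open>[1]\<close> has its term at least 2, so the
      alternative \<open>length cs = 1\<close> is absorbed. Thus the standardness criterion passes
      from a list to its tail.\<close>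
    have last2: "(length cs = 1 \<or> 2 \<le> last cs) = (2 \<le> last cs)"
      if "cs \<noteq> []" "cs \<noteq> [1]" "\<forall>c \<in> set cs. 1 \<le> c" for cs :: "int list"
      using that by (cases cs) auto
    have "as = bs'"
    proof (rule Cons.IH)
      show "is_cf as (cf_value as)" "is_cf bs' (cf_value as)"
        using Cons.prems(1,2) as' bs' bs eq by (simp_all add: is_cf_Cons_iff)
      have "\<forall>c \<in> set as. 1 \<le> c" "\<forall>c \<in> set bs'. 1 \<le> c"
        using Cons.prems(1,2) as' bs' bs by (simp_all add: is_cf_Cons_iff)
      then show "even (length as) = even (length bs') \<or>
        (length as = 1 \<or> 2 \<le> last as) = (length bs' = 1 \<or> 2 \<le> last bs')"
        using Cons.prems(3) as' bs' bs by (simp add: last2[unfolded One_nat_def])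
    qed
    then show ?thesis using A(2) B(2) bs by simp
  qed
qed

text \<open>This is the Euclidean algorithm as an induction on the denominator: if r is the nonzero
  remainder of p modulo n, then p/n is an integer plus 1/(n/r), and n/r has the smaller denominator
  r.\<close>

lemma Rats_cf_induct [consumes 1, case_names int step]:
  assumes "x \<in> \<rat>"
    and int: "\<And>k. P (of_int k)"
    and step: "\<And>a y. 1 < y \<Longrightarrow> P y \<Longrightarrow> P (of_int a + 1 / y)"
  shows "P (x :: real)"
proof -
  have "P (of_int p / of_nat n)" if "0 < n" for p n
    using that
  proof (induction n arbitrary: p rule: less_induct)
    case (less n)
    define r where "r = p mod int n"
    have p: "p = int n * (p div int n) + r" by (simp add: r_def)
    have r: "0 \<le> r" "r < int n" using less.prems by (auto simp: r_def)
    have "real_of_int p = of_int (int n * (p div int n) + r)" by (subst p) simp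
    then have x: "of_int p / real n = of_int (p div int n) + of_int r / real n"
      using less.prems by (simp add: field_simps)
    show ?case
    proof (cases "r = 0")
      case True
      then show ?thesis using x int by simp
    next
      case False
      define k where "k = nat r"
      have k: "0 < k" "k < n" "r = int k" using r False by (auto simp: k_def)
      have "P (of_int (int n) / real k)" using less.IH[of k "int n"] k by simp
      moreover have "1 < of_int (int n) / real k" using k by simp
      ultimately have "P (of_int (p div int n) + 1 / (of_int (int n) / real k))"
        by (rule step[rotated])
      then show ?thesis using x k by simp
    qed
  qed
  moreover obtain p n where "0 < n" "x = of_int p / of_nat n"
    using assms(1) by (metis Rats_cases' of_nat_nat of_int_of_nat_eq zero_less_nat_eq less_imp_le zero_less_imp_eq_int)
  ultimately show ?thesis by blast
qed

text \<open>The head of an expansion of y may be any integer, but as a later term it must be at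
  least 1. This is what \<open>1 < y\<close> guarantees.\<close>

lemma is_cf_ConsI:
  assumes "is_cf as y" "1 < y"
  shows "is_cf (a # as) (of_int a + 1 / y)"
proof -
  obtain b bs where as: "as = b # bs" using assms(1) by (cases as) (auto simp: is_cf_def)
  have "1 \<le> b"
  proof (cases "bs = []")
    case True
    then show ?thesis using assms by (simp add: as is_cf_def)
  next
    case False
    have "1 \<le> cf_value bs"
      using cf_value_ge_1[of bs] assms(1) False by (simp add: as is_cf_Cons_iff)
    then have "1 / cf_value bs \<le> 1" by simp
    moreover have "y = of_int b + 1 / cf_value bs"
      using assms(1) False by (simp add: as is_cf_Cons_iff)
    ultimately have "0 < real_of_int b" using assms(2) by linarith
    then show ?thesis by simp
  qed
  then show ?thesis using assms(1) by (auto simp: is_cf_def as cf_value_Cons)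
qed

lemma is_cf_ex_parity:
  assumes "x \<in> \<rat>"
  shows "\<exists>as. is_cf as x \<and> even (length as) = e"
  using assms
proof (induction x arbitrary: e rule: Rats_cf_induct)
  case (int k)
  have "is_cf [k] (of_int k)" "is_cf [k - 1, 1] (of_int k)" by (simp_all add: is_cf_def)
  moreover have "even (length [k]) = False" "even (length [k - 1, 1]) = True" by simp_all
  ultimately show ?case by (metis (full_types))
next
  case (step a y)
  \<comment> \<open>Prepending a term flips the parity of the length, hence the opposite parity for
    the tail.\<close>
  obtain as where "is_cf as y" "even (length as) = (\<not> e)" using step.IH by blast
  then show ?case using is_cf_ConsI[OF _ step.hyps, of as a] by (intro exI[of _ "a # as"]) auto
qed

lemma is_cf_ex_standard:
  assumes "x \<in> \<rat>"
  shows "\<exists>as. is_cf as x \<and> (length as = 1 \<or> 2 \<le> last as)"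
  using assms
proof (induction x rule: Rats_cf_induct)
  case (int k)
  have "is_cf [k] (of_int k)" by (simp add: is_cf_def)
  then show ?case by (metis length_Cons list.size(3) One_nat_def)
next
  case (step a y)
  then obtain as where as: "is_cf as y" "length as = 1 \<or> 2 \<le> last as" by blast
  \<comment> \<open>The extended list has more than one term, so only the condition on the last term
    can hold; for a one-term tail it follows from \<open>1 < y\<close>.\<close>
  have "2 \<le> last as"
  proof (cases "length as = 1")
    case True
    then obtain b where "as = [b]" by (auto simp: length_Suc_conv)
    then show ?thesis using as(1) step.hyps by (auto simp: is_cf_def)
  qed (use as in auto)
  moreover have "as \<noteq> []" using as(1) by (simp add: is_cf_def)
  ultimately show ?case
    using is_cf_ConsI[OF as(1) step.hyps, of a] by (intro exI[of _ "a # as"]) auto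
qed

lemma is_cf_standard_cf:
  assumes "x \<in> \<rat>"
  shows "is_cf (standard_cf x) x"
proof -
  have "\<exists>!as. is_cf as x \<and> (length as = 1 \<or> 2 \<le> last as)"
    using is_cf_ex_standard[OF assms] is_cf_unique by (metis (no_types, lifting))
  from theI'[OF this] show ?thesis by (simp add: standard_cf_def)
qed

lemma is_cf_odd_cf:
  assumes "x \<in> \<rat>"
  shows "is_cf (odd_cf x) x" "even (length (odd_cf x))"
proof -
  have "\<exists>!as. is_cf as x \<and> even (length as)"
    using is_cf_ex_parity[OF assms, of True] is_cf_unique by (metis (no_types, lifting))
  from theI'[OF this] show "is_cf (odd_cf x) x" "even (length (odd_cf x))"
    by (simp_all add: odd_cf_def)
qed


section \<open>The matrix of a continued fraction\<close>

lemma mat2_entries: "(M :: mat2) = mat2 (M $ 1 $ 1) (M $ 1 $ 2) (M $ 2 $ 1) (M $ 2 $ 2)"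
  by (simp add: vec_eq_iff forall_2)

lemma mat2_eq_iff:
  "mat2 a b c d = mat2 a' b' c' d' \<longleftrightarrow> a = a' \<and> b = b' \<and> c = c' \<and> d = d'"
  by (auto simp: vec_eq_iff forall_2)

lemma det_mat2: "det (mat2 a b c d) = a * d - b * c"
  by (simp add: det_2)

lemma matrix_inv_R: "matrix_inv mat_R = mat2 1 0 (- 1) 1"
proof -
  let ?N = "mat2 1 0 (- 1) 1"
  have N: "mat_R ** ?N = mat 1" "?N ** mat_R = mat 1"
    by (simp_all add: mat_R_def mat2_mult mat_1_eq)
  have "mat_R ** matrix_inv mat_R = mat 1 \<and> matrix_inv mat_R ** mat_R = mat 1"
    unfolding matrix_inv_def by (rule someI[of _ ?N]) (use N in blast)
  then have "?N = (?N ** mat_R) ** matrix_inv mat_R"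
    by (metis matrix_mul_assoc matrix_mul_rid)
  then show ?thesis by (simp only: N(2) matrix_mul_lid)
qed

lemma mat_zpow_R: "mat_zpow mat_R k = mat2 1 0 k 1"
proof -
  have 1: "(((**) mat_R) ^^ n) (mat 1) = mat2 1 0 (int n) 1" for n
    by (induction n) (simp_all add: mat_1_eq mat_R_def mat2_mult add.commute)
  have 2: "(((**) (matrix_inv mat_R)) ^^ n) (mat 1) = mat2 1 0 (- int n) 1" for n
    by (induction n) (simp_all add: mat_1_eq matrix_inv_R mat2_mult algebra_simps)
  show ?thesis by (simp add: mat_zpow_def 1 2)
qed

text \<open>Conjugation by the permutation matrix of the two coordinates interchanges L and R, and
  reverses the order of both rows and columns of a product.\<close>

lemma alternating_prod_swap:
  "alternating_prod mat_L mat_R as = mat2 \<alpha> \<beta> \<gamma> \<delta> \<longleftrightarrow>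
   alternating_prod mat_R mat_L as = mat2 \<delta> \<gamma> \<beta> \<alpha>"
proof (induction as arbitrary: \<alpha> \<beta> \<gamma> \<delta>)
  case Nil
  show ?case by (auto simp: mat_1_eq mat2_eq_iff)
next
  case (Cons a as)
  obtain p q r s where "alternating_prod mat_L mat_R as = mat2 p q r s"
    using mat2_entries by blast
  moreover from this have "alternating_prod mat_R mat_L as = mat2 s r q p"
    using Cons.IH by blast
  ultimately show ?case
    by (auto simp: mat_zpow_L mat_zpow_R mat2_mult mat2_eq_iff)
qed

text \<open>The tail of a product starting with L starts with R; swapping expresses it by the
  product starting with L again, so inductions close. As in a + 1/x, the numerators of the tail
  become the denominators of the whole.\<close>

lemma alternating_prod_LR_Cons:
  assumes "alternating_prod mat_L mat_R as = mat2 \<alpha> \<beta> \<gamma> \<delta>"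
  shows "alternating_prod mat_L mat_R (a # as) = mat2 (\<delta> + a * \<beta>) (\<gamma> + a * \<alpha>) \<beta> \<alpha>"
  using assms by (simp add: alternating_prod_swap mat_zpow_L mat2_mult)

lemma det_alternating_prod_LR: "det (alternating_prod mat_L mat_R as) = 1"
proof (induction as)
  case Nil
  show ?case by simp
next
  case (Cons a as)
  obtain p q r s where M: "alternating_prod mat_L mat_R as = mat2 p q r s"
    using mat2_entries by blast
  show ?case using Cons.IH
    unfolding alternating_prod_LR_Cons[OF M] M det_mat2 by (simp add: algebra_simps)
qed

text \<open>The bounds on numerators are carried along because they turn into the bounds on
  denominators after another term is prepended. Each prepended term also exchanges the roles of the
  columns.\<close>

lemma alternating_prod_LR_positive:
  assumes "as \<noteq> []" "\<forall>a \<in> set as. 1 \<le> a"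
    and "alternating_prod mat_L mat_R as = mat2 \<alpha> \<beta> \<gamma> \<delta>"
  shows "if even (length as)
    then 0 \<le> \<beta> \<and> \<beta> \<le> \<alpha> \<and> 0 < \<alpha> \<and> 0 < \<delta> \<and> \<delta> \<le> \<gamma> \<and> cf_value as = of_int \<alpha> / of_int \<gamma>
    else 0 < \<alpha> \<and> \<alpha> \<le> \<beta> \<and> 0 \<le> \<gamma> \<and> \<gamma> \<le> \<delta> \<and> 0 < \<delta> \<and> cf_value as = of_int \<beta> / of_int \<delta>"
  using assms
proof (induction as arbitrary: \<alpha> \<beta> \<gamma> \<delta>)
  case (Cons a as)
  obtain p q r s where M: "alternating_prod mat_L mat_R as = mat2 p q r s"
    using mat2_entries by blast
  have e: "\<alpha> = s + a * q" "\<beta> = r + a * p" "\<gamma> = q" "\<delta> = p"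
    using Cons.prems(3) alternating_prod_LR_Cons[OF M, of a] by (simp_all add: mat2_eq_iff)
  have a: "1 \<le> a" using Cons.prems by simp
  show ?case
  proof (cases "as = []")
    case True
    then have "p = 1" "q = 0" "r = 0" "s = 1" using M by (auto simp: mat_1_eq mat2_eq_iff)
    then show ?thesis using True a e by simp
  next
    case False
    note IH = Cons.IH[OF False _ M]
    show ?thesis
    proof (cases "even (length as)")
      case True
      then have h: "0 \<le> q" "q \<le> p" "0 < p" "0 < s" "s \<le> r" "cf_value as = of_int p / of_int r"
        using IH Cons.prems by auto
      have "a * q \<le> a * p" "0 \<le> a * q" using h a by (auto intro: mult_left_mono)
      then show ?thesis using True e h False
        by (simp add: cf_value_Cons) (simp add: field_simps)
    next
      case odd: False
      then have h: "0 < p" "p \<le> q" "0 \<le> r" "r \<le> s" "0 < s" "cf_value as = of_int q / of_int s"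
        using IH Cons.prems by auto
      have "a * p \<le> a * q" "0 < a * p" using h a by (auto intro: mult_left_mono)
      then show ?thesis using odd e h False
        by (simp add: cf_value_Cons) (simp add: field_simps)
    qed
  qed
qed simp

text \<open>The first term may be negative, which spoils the bounds on numerators. The bottom row
  depends only on the tail, whose terms are positive, so the denominators keep their sign and
  order.\<close>

lemma alternating_prod_LR_cf:
  assumes "is_cf as x" and M: "alternating_prod mat_L mat_R as = mat2 \<alpha> \<beta> \<gamma> \<delta>"
  shows "if even (length as)
    then 0 < \<delta> \<and> \<delta> \<le> \<gamma> \<and> x = of_int \<alpha> / of_int \<gamma> else 0 < \<delta> \<and> x = of_int \<beta> / of_int \<delta>"
proof -
  obtain a bs where as: "as = a # bs" using assms(1) by (cases as) (auto simp: is_cf_def)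
  obtain p q r s where N: "alternating_prod mat_L mat_R bs = mat2 p q r s"
    using mat2_entries by blast
  have e: "\<alpha> = s + a * q" "\<beta> = r + a * p" "\<gamma> = q" "\<delta> = p"
    using M alternating_prod_LR_Cons[OF N, of a] by (simp_all add: as mat2_eq_iff)
  show ?thesis
  proof (cases "bs = []")
    case True
    then have "p = 1" "q = 0" "r = 0" "s = 1" using N by (auto simp: mat_1_eq mat2_eq_iff)
    then show ?thesis using True e as assms(1) by (simp add: is_cf_def)
  next
    case False
    have x: "x = of_int a + 1 / cf_value bs" and "\<forall>b \<in> set bs. 1 \<le> b"
      using assms(1) False by (simp_all add: as is_cf_Cons_iff)
    from alternating_prod_LR_positive[OF False this(2) N] show ?thesis
      by (auto simp: as e x field_simps split: if_splits)
  qed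
qed


section \<open>The action on forms\<close>

lemma act_mat2:
  "act (Form a b c) (mat2 \<alpha> \<beta> \<gamma> \<delta>) =
    Form (a * \<alpha>\<^sup>2 + b * \<alpha> * \<gamma> + c * \<gamma>\<^sup>2)
      (2 * a * \<alpha> * \<beta> + b * (\<alpha> * \<delta> + \<beta> * \<gamma>) + 2 * c * \<gamma> * \<delta>)
      (a * \<beta>\<^sup>2 + b * \<beta> * \<delta> + c * \<delta>\<^sup>2)"
  by (simp add: act_def)

lemma act_mult: "act (act q M) N = act q (M ** N)"
  by (simp add: act_def Let_def matrix_matrix_mult_def sum_2 power2_eq_square algebra_simps)

lemma act_mat_1 [simp]: "act q (mat 1) = q"
  by (cases q) (simp add: mat_1_eq act_mat2)

lemma disc_act: "disc (act q M) = disc q * (det M)\<^sup>2"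
  by (simp add: disc_def act_def Let_def det_2 power2_eq_square algebra_simps)

lemma equivalent_act: "det M = 1 \<Longrightarrow> equivalent (act q M) q"
  unfolding equivalent_def by blast

lemma equivalent_sym:
  assumes "equivalent q q'"
  shows "equivalent q' q"
proof -
  obtain M where M: "det M = 1" "q = act q' M" using assms by (auto simp: equivalent_def)
  obtain a b c d where abcd: "M = mat2 a b c d" using mat2_entries by blast
  define N where "N = mat2 d (- b) (- c) a"
  have d: "a * d - b * c = 1" using M(1) unfolding abcd det_mat2 .
  have "det N = 1" unfolding N_def det_mat2 using d by (simp add: algebra_simps)
  moreover have "M ** N = mat 1"
    unfolding abcd N_def mat2_mult mat_1_eq mat2_eq_iff using d by (simp add: algebra_simps)
  then have "q' = act q N" by (simp add: M(2) act_mult)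
  ultimately show ?thesis unfolding equivalent_def by blast
qed

lemma equivalent_trans:
  assumes "equivalent q q'" "equivalent q' q''"
  shows "equivalent q q''"
proof -
  obtain M N where "det M = 1" "q = act q' M" "det N = 1" "q' = act q'' N"
    using assms by (auto simp: equivalent_def)
  then have "det (N ** M) = 1" "q = act q'' (N ** M)" by (simp_all add: det_mul act_mult)
  then show ?thesis unfolding equivalent_def by blast
qed

lemma equivalent_disc: "equivalent q q' \<Longrightarrow> disc q = disc q'"
  by (auto simp: equivalent_def disc_act)

lemma equivalent_reduced_eq:
  assumes "equivalent q q'" "reduced q" "reduced q'"
  shows "q = q'"
proof -
  obtain m c where q: "q = Form 0 m c" "0 \<le> m" "m = 0 \<or> 0 < c \<and> c \<le> m"
    using assms(2) unfolding reduced_def by force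
  obtain m' c' where q': "q' = Form 0 m' c'" "0 \<le> m'" "m' = 0 \<or> 0 < c' \<and> c' \<le> m'"
    using assms(3) unfolding reduced_def by force
  have "m\<^sup>2 = m'\<^sup>2" using equivalent_disc[OF assms(1)] by (simp add: q q' disc_def)
  then have m: "m' = m" using q(2) q'(2) by simp
  obtain M where M: "det M = 1" "q = act q' M" using assms(1) by (auto simp: equivalent_def)
  obtain \<alpha> \<beta> \<gamma> \<delta> where M2: "M = mat2 \<alpha> \<beta> \<gamma> \<delta>" using mat2_entries by blast
  have d: "\<alpha> * \<delta> - \<beta> * \<gamma> = 1" using M(1) unfolding M2 det_mat2 .
  have e: "m * \<alpha> * \<gamma> + c' * \<gamma>\<^sup>2 = 0" "m * (\<alpha> * \<delta> + \<beta> * \<gamma>) + 2 * c' * \<gamma> * \<delta> = m"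
    "m * \<beta> * \<delta> + c' * \<delta>\<^sup>2 = c"
    using M(2) unfolding q q' m M2 act_mat2 by simp_all
  have "c = c'"
  proof (cases "\<gamma> = 0")
    case True
    then have "\<alpha> * \<delta> = 1" using d by simp
    then have "\<delta> = 1 \<or> \<delta> = - 1" by (metis mult.commute zmult_eq_1_iff)
    then have c: "\<delta>\<^sup>2 = 1" by auto
    then have eq: "c - c' = m * (\<beta> * \<delta>)" using e(3) by (simp add: algebra_simps)
    show ?thesis
    proof (cases "m = 0")
      case True
      then show ?thesis using eq by simp
    next
      case False
      \<comment> \<open>Both numbers lie between 1 and m, so congruence modulo m forces
        equality.\<close>
      then have "\<bar>c - c'\<bar> < m" using q q' m by auto
      moreover have "m dvd c - c'" using eq by simp
      ultimately show ?thesis using dvd_imp_le_int[of "c - c'" m] by auto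
    qed
  next
    case False
    have "\<gamma> * (m * \<alpha> + c' * \<gamma>) = 0" using e(1) by (simp add: power2_eq_square algebra_simps)
    then have ma: "c' * \<gamma> = - (m * \<alpha>)" using False by simp
    \<comment> \<open>Eliminating \<open>c' * \<gamma>\<close> from the middle coefficient gives m =
      -m. Hence a nonzero \<gamma> is possible only for m = 0, and then c' and c both
      vanish.\<close>
    have "m = m * (\<alpha> * \<delta> + \<beta> * \<gamma>) + 2 * (c' * \<gamma>) * \<delta>" using e(2) by simp
    also have "\<dots> = - m * (\<alpha> * \<delta> - \<beta> * \<gamma>)" unfolding ma by (simp add: algebra_simps)
    finally have "m = 0" using d by simp
    then show ?thesis using ma e(3) False by simp
  qed
  then show ?thesis by (simp add: q q' m)
qed


section \<open>The two steps of the algorithm\<close>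

text \<open>
  A root \<open>p / r\<close> is the first or the second root according to whether the vector \<open>(p, r)\<close>
  is mapped by the Gram matrix of the form to \<open>m\<close> or \<open>- m\<close> times \<open>(r, - p)\<close>. This covers the
  forms with vanishing first coefficient without a case distinction.
\<close>

lemma root1_Point:
  assumes "disc (Form a b c) = m\<^sup>2" "0 \<le> m" "root1 (Form a b c) = Point x"
  shows "x \<in> \<rat>"
    and "x = of_int p / of_int r \<Longrightarrow> r \<noteq> 0 \<Longrightarrow>
      2 * a * p + b * r = m * r \<and> b * p + 2 * c * r = - m * p"
proof -
  have D: "b\<^sup>2 - 4 * a * c = m\<^sup>2" using assms(1) by (simp add: disc_def)
  have sq: "sqrt (of_int (disc (Form a b c))) = of_int m" using assms(1,2) by simp
  have x: "if a \<noteq> 0 then x = of_int (m - b) / of_int (2 * a)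
    else 0 < b \<and> x = of_int (- c) / of_int b"
    using assms(3) sq by (auto simp: root1_def neg_quotient_def split: if_splits)
  show "x \<in> \<rat>" using x by (auto split: if_splits)
  assume xp: "x = of_int p / of_int r" and r: "r \<noteq> 0"
  show "2 * a * p + b * r = m * r \<and> b * p + 2 * c * r = - m * p"
  proof (cases "a = 0")
    case True
    \<comment> \<open>A finite first root with a = 0 means b > 0, which selects the positive square
      root of the discriminant.\<close>
    then have "b = m" using x D assms(2) by simp
    moreover have "real_of_int (b * p) = of_int (- c * r)"
      using x xp r True by (simp add: field_simps)
    then have "b * p = - c * r" by (simp only: of_int_eq_iff)
    ultimately show ?thesis using True by simp
  next
    case False
    have "real_of_int (2 * a * p) = of_int ((m - b) * r)"
      using x xp r False by (simp add: field_simps)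
    then have 1: "2 * a * p = (m - b) * r" by (simp only: of_int_eq_iff)
    \<comment> \<open>The second equation follows from the first after multiplication by 2a, since
      4ac is the difference of the squares of b and m.\<close>
    have "2 * a * (b * p + 2 * c * r) = b * (2 * a * p) + 4 * a * c * r"
      by (simp add: algebra_simps)
    also have "\<dots> = b * ((m - b) * r) + (b\<^sup>2 - m\<^sup>2) * r" using 1 D by simp
    also have "\<dots> = - m * ((m - b) * r)" by (simp add: power2_eq_square algebra_simps)
    also have "\<dots> = 2 * a * (- m * p)" unfolding 1[symmetric] by simp
    finally have "b * p + 2 * c * r = - m * p"
      using False by (subst (asm) mult_cancel_left) simp
    then show ?thesis using 1 by (simp add: algebra_simps)
  qed
qed

text \<open>The column representing the root is the first for an even number of terms and the second
  for an odd number, so the matrix takes \<infinity> or 0 to the root, and the corresponding outer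
  coefficient vanishes. An infinite root needs no move.\<close>

lemma step1_cases:
  assumes "disc q = m\<^sup>2" "0 \<le> m"
  shows "det (step1_matrix q) = 1"
    and "\<exists>k. step1 q = Form 0 (- m) k \<or> step1 q = Form k m 0"
proof -
  obtain a b c where q: "q = Form a b c" by (cases q)
  have "det (step1_matrix q) = 1 \<and> (\<exists>k. step1 q = Form 0 (- m) k \<or> step1 q = Form k m 0)"
  proof (cases "root1 q")
    case Infty
    then have "a = 0" "b \<le> 0"
      by (auto simp: q root1_def neg_quotient_def split: if_splits)
    then have "b = - m" using assms by (auto simp: q disc_def power2_eq_iff)
    moreover have "step1_matrix q = mat 1"
      by (simp add: step1_matrix_def associated_matrix_def Infty)
    ultimately show ?thesis using \<open>a = 0\<close> by (auto simp: step1_def q)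
  next
    case (Point x)
    note root = root1_Point[OF assms[unfolded q] Point[unfolded q]]
    define as where "as = standard_cf x"
    have M1: "step1_matrix q = alternating_prod mat_L mat_R as"
      by (simp add: step1_matrix_def associated_matrix_def Point as_def)
    obtain \<alpha> \<beta> \<gamma> \<delta> where M: "alternating_prod mat_L mat_R as = mat2 \<alpha> \<beta> \<gamma> \<delta>"
      using mat2_entries by blast
    have "det (alternating_prod mat_L mat_R as) = 1" by (rule det_alternating_prod_LR)
    then have d: "\<alpha> * \<delta> - \<beta> * \<gamma> = 1" unfolding M det_mat2 .
    have cf: "is_cf as x" unfolding as_def by (rule is_cf_standard_cf[OF root(1)])
    note col = alternating_prod_LR_cf[OF cf M]
    have s: "step1 q = Form (a * \<alpha>\<^sup>2 + b * \<alpha> * \<gamma> + c * \<gamma>\<^sup>2)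
      (2 * a * \<alpha> * \<beta> + b * (\<alpha> * \<delta> + \<beta> * \<gamma>) + 2 * c * \<gamma> * \<delta>)
      (a * \<beta>\<^sup>2 + b * \<beta> * \<delta> + c * \<delta>\<^sup>2)"
      unfolding step1_def M1 M unfolding q act_mat2 ..
    show ?thesis
    proof (cases "even (length as)")
      case True
      then have "2 * a * \<alpha> + b * \<gamma> = m * \<gamma>" "b * \<alpha> + 2 * c * \<gamma> = - m * \<alpha>"
        using root(2)[of \<alpha> \<gamma>] col by auto
      \<comment> \<open>Let v be the root column, w the other column and G the Gram matrix. Twice
        the outer coefficient is v^T G v and the middle one is w^T G v. Since G v is m times
        (\<gamma>, -\<alpha>), the first is 0 and the second is -m times the determinant.\<close>
      moreover have "2 * (a * \<alpha>\<^sup>2 + b * \<alpha> * \<gamma> + c * \<gamma>\<^sup>2) =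
        \<alpha> * (2 * a * \<alpha> + b * \<gamma>) + \<gamma> * (b * \<alpha> + 2 * c * \<gamma>)"
        by (simp add: power2_eq_square algebra_simps)
      moreover have "2 * a * \<alpha> * \<beta> + b * (\<alpha> * \<delta> + \<beta> * \<gamma>) + 2 * c * \<gamma> * \<delta> =
        \<beta> * (2 * a * \<alpha> + b * \<gamma>) + \<delta> * (b * \<alpha> + 2 * c * \<gamma>)"
        by (simp add: algebra_simps)
      moreover have "\<beta> * (m * \<gamma>) + \<delta> * (- m * \<alpha>) = - m * (\<alpha> * \<delta> - \<beta> * \<gamma>)"
        by (simp add: algebra_simps)
      ultimately have "step1 q = Form 0 (- m) (a * \<beta>\<^sup>2 + b * \<beta> * \<delta> + c * \<delta>\<^sup>2)"
        unfolding s using d by simp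
      then show ?thesis using M1 det_alternating_prod_LR by auto
    next
      case False
      then have "2 * a * \<beta> + b * \<delta> = m * \<delta>" "b * \<beta> + 2 * c * \<delta> = - m * \<beta>"
        using root(2)[of \<beta> \<delta>] col by auto
      moreover have "2 * (a * \<beta>\<^sup>2 + b * \<beta> * \<delta> + c * \<delta>\<^sup>2) =
        \<beta> * (2 * a * \<beta> + b * \<delta>) + \<delta> * (b * \<beta> + 2 * c * \<delta>)"
        by (simp add: power2_eq_square algebra_simps)
      moreover have "2 * a * \<alpha> * \<beta> + b * (\<alpha> * \<delta> + \<beta> * \<gamma>) + 2 * c * \<gamma> * \<delta> =
        \<alpha> * (2 * a * \<beta> + b * \<delta>) + \<gamma> * (b * \<beta> + 2 * c * \<delta>)"
        by (simp add: algebra_simps)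
      moreover have "\<alpha> * (m * \<delta>) + \<gamma> * (- m * \<beta>) = m * (\<alpha> * \<delta> - \<beta> * \<gamma>)"
        by (simp add: algebra_simps)
      ultimately have "step1 q = Form (a * \<alpha>\<^sup>2 + b * \<alpha> * \<gamma> + c * \<gamma>\<^sup>2) m 0"
        unfolding s using d by simp
      then show ?thesis using M1 det_alternating_prod_LR by auto
    qed
  qed
  then show "det (step1_matrix q) = 1"
    "\<exists>k. step1 q = Form 0 (- m) k \<or> step1 q = Form k m 0" by auto
qed

text \<open>The given fraction need not be in lowest terms, so its equality with the convergent is
  recorded in cross-multiplied form.\<close>

lemma associated_matrix_odd_cf:
  assumes "x = of_int n / of_int d" "d \<noteq> 0"
  obtains \<alpha> \<beta> \<gamma> \<delta> where "associated_matrix odd_cf (Point x) = mat2 \<alpha> \<beta> \<gamma> \<delta>"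
    "\<alpha> * \<delta> - \<beta> * \<gamma> = 1" "0 < \<delta>" "\<delta> \<le> \<gamma>" "\<alpha> * d = n * \<gamma>"
proof -
  have "x \<in> \<rat>" using assms by simp
  note cf = is_cf_odd_cf[OF this]
  obtain \<alpha> \<beta> \<gamma> \<delta> where M: "alternating_prod mat_L mat_R (odd_cf x) = mat2 \<alpha> \<beta> \<gamma> \<delta>"
    using mat2_entries by blast
  have "det (alternating_prod mat_L mat_R (odd_cf x)) = 1" by (rule det_alternating_prod_LR)
  then have D: "\<alpha> * \<delta> - \<beta> * \<gamma> = 1" unfolding M det_mat2 .
  have b: "0 < \<delta>" "\<delta> \<le> \<gamma>" "x = of_int \<alpha> / of_int \<gamma>"
    using alternating_prod_LR_cf[OF cf(1) M] cf(2) by auto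
  have "real_of_int (\<alpha> * d) = of_int (n * \<gamma>)" using assms b by (simp add: field_simps)
  then have "\<alpha> * d = n * \<gamma>" by (simp only: of_int_eq_iff)
  then show ?thesis using that M D b by (simp add: associated_matrix_def)
qed

lemma det_mat_L: "det mat_L = 1"
  by (simp add: mat_L_def det_mat2)

lemma det_step2_matrix: "det (step2_matrix q) = 1"
proof -
  have "det (associated_matrix odd_cf p) = 1" for p
    by (cases p) (simp_all add: associated_matrix_def det_alternating_prod_LR)
  then show ?thesis by (simp add: step2_matrix_def Let_def det_mul det_mat_L)
qed

text \<open>The extra factor L only turns [0,m,0] into [0,m,m], so it suffices to compute with the
  uncorrected matrix.\<close>

lemma act_step2_matrix:
  assumes "act q (associated_matrix odd_cf (root2 q)) = Form 0 m c" "0 \<le> m"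
  shows "act q (step2_matrix q) = Form 0 m (if c = 0 then m else c)"
proof (cases "c = 0")
  case True
  then have "\<exists>m\<ge>0. act q (associated_matrix odd_cf (root2 q)) = Form 0 m 0"
    using assms by auto
  then have "step2_matrix q = associated_matrix odd_cf (root2 q) ** mat_L"
    by (simp add: step2_matrix_def)
  then show ?thesis using assms True by (simp add: act_mult[symmetric] mat_L_def act_mat2)
next
  case False
  then show ?thesis using assms by (simp add: step2_matrix_def)
qed

lemma step2_disc_0:
  assumes "q = Form 0 0 k \<or> q = Form k 0 0"
  shows "act q (step2_matrix q) = Form 0 0 k"
proof -
  have "act q (associated_matrix odd_cf (root2 q)) = Form 0 0 k"
  proof (cases "q = Form 0 0 k")
    case True
    then show ?thesis by (simp add: root2_def neg_quotient_def associated_matrix_def)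
  next
    case False
    then have q: "q = Form k 0 0" "k \<noteq> 0" using assms by auto
    \<comment> \<open>The zero is written as \<open>of_int 0\<close> so that
      \<open>odd_cf_int\<close> applies; the expansion \<open>[- 1, 1]\<close> gives a matrix that
      moves the coefficient k from the first to the last place.\<close>
    then have r: "root2 q = Point (of_int 0)" by (simp add: root2_def disc_def)
    show ?thesis
      unfolding r associated_matrix_def
      by (simp del: of_int_0 add: odd_cf_int q(1) mat_zpow_L mat_zpow_R mat_1_eq mat2_mult act_mat2)
  qed
  from act_step2_matrix[OF this] show ?thesis by simp
qed

lemma step2_first_infinite:
  assumes "0 < m"
  shows "\<exists>c. act (Form 0 (- m) k) (step2_matrix (Form 0 (- m) k)) = Form 0 m c \<and> 0 < c \<and> c \<le> m"
proof -
  let ?q = "Form 0 (- m) k"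
  have r: "root2 ?q = Point (of_int k / of_int m)"
    using assms by (simp add: root2_def neg_quotient_def)
  obtain \<alpha> \<beta> \<gamma> \<delta> where
    M: "associated_matrix odd_cf (Point (of_int k / of_int m)) = mat2 \<alpha> \<beta> \<gamma> \<delta>"
    and h: "\<alpha> * \<delta> - \<beta> * \<gamma> = 1" "0 < \<delta>" "\<delta> \<le> \<gamma>" "\<alpha> * m = k * \<gamma>"
    using associated_matrix_odd_cf[where n = k and d = m, OF refl] assms
    by (metis less_irrefl)
  define c where "c = - m * \<beta> * \<delta> + k * \<delta>\<^sup>2"
  have "- m * \<alpha> * \<gamma> + k * \<gamma>\<^sup>2 = \<gamma> * (k * \<gamma> - \<alpha> * m)"
    by (simp add: power2_eq_square algebra_simps)
  moreover have "- m * (\<alpha> * \<delta> + \<beta> * \<gamma>) + 2 * k * \<gamma> * \<delta> =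
    m * (\<alpha> * \<delta> - \<beta> * \<gamma>) + 2 * \<delta> * (k * \<gamma> - \<alpha> * m)"
    by (simp add: algebra_simps)
  ultimately have q2: "act ?q (associated_matrix odd_cf (root2 ?q)) = Form 0 m c"
    unfolding r M act_mat2 c_def using h by simp
  \<comment> \<open>After multiplication by \<gamma>, the root equation and the determinant reduce
    this to \<open>m * \<delta>\<close>; both bounds on c then follow from 0 < \<delta> \<le>
    \<gamma>.\<close>
  have "c * \<gamma> = \<delta> * (\<delta> * (k * \<gamma>) - m * \<beta> * \<gamma>)"
    by (simp add: c_def power2_eq_square algebra_simps)
  also have "\<dots> = m * \<delta> * (\<alpha> * \<delta> - \<beta> * \<gamma>)"
    unfolding h(4)[symmetric] by (simp add: algebra_simps)
  finally have cg: "c * \<gamma> = m * \<delta>" using h by simp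
  have "0 < \<gamma>" using h by simp
  have "0 < c * \<gamma>" using cg assms h by simp
  then have "0 < c" using \<open>0 < \<gamma>\<close> by (simp add: zero_less_mult_iff)
  moreover have "c * \<gamma> \<le> m * \<gamma>" using cg assms h by simp
  then have "c \<le> m" using \<open>0 < \<gamma>\<close> by simp
  ultimately show ?thesis using act_step2_matrix[OF q2] assms by auto
qed

text \<open>For nonzero k, both \<open>c * \<gamma> = - k * \<beta>\<close> and
  \<open>m * \<gamma> = - k * \<alpha>\<close> hold, so comparing c with m amounts to comparing
  \<beta> with \<alpha>, in a direction given by the sign of k.\<close>

lemma step2_first_zero:
  assumes "0 < m"
  shows "\<exists>c. act (Form k m 0) (step2_matrix (Form k m 0)) = Form 0 m c \<and> 0 < c \<and>
    (c \<le> m \<or> 0 < k \<and> k dvd m \<and> c = m + k)"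
proof (cases "k = 0")
  case True
  let ?q = "Form k m 0"
  have "root2 ?q = Infty" using assms True by (simp add: root2_def)
  then have "act ?q (associated_matrix odd_cf (root2 ?q)) = Form 0 m 0"
    by (simp add: associated_matrix_def True)
  from act_step2_matrix[OF this] show ?thesis using assms by auto
next
  case False
  let ?q = "Form k m 0"
  have r: "root2 ?q = Point (of_int (- m) / of_int k)"
    using assms False by (simp add: root2_def disc_def)
  obtain \<alpha> \<beta> \<gamma> \<delta> where
    M: "associated_matrix odd_cf (Point (of_int (- m) / of_int k)) = mat2 \<alpha> \<beta> \<gamma> \<delta>"
    and h: "\<alpha> * \<delta> - \<beta> * \<gamma> = 1" "0 < \<delta>" "\<delta> \<le> \<gamma>" "\<alpha> * k = - m * \<gamma>"
    using associated_matrix_odd_cf[where n = "- m" and d = k, OF refl False] by blast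
  define c where "c = k * \<beta>\<^sup>2 + m * \<beta> * \<delta>"
  have "k * \<alpha>\<^sup>2 + m * \<alpha> * \<gamma> = \<alpha> * (\<alpha> * k + m * \<gamma>)"
    by (simp add: power2_eq_square algebra_simps)
  moreover have "2 * k * \<alpha> * \<beta> + m * (\<alpha> * \<delta> + \<beta> * \<gamma>) =
    m * (\<alpha> * \<delta> - \<beta> * \<gamma>) + 2 * \<beta> * (\<alpha> * k + m * \<gamma>)"
    by (simp add: algebra_simps)
  ultimately have q2: "act ?q (associated_matrix odd_cf (root2 ?q)) = Form 0 m c"
    unfolding r M act_mat2 c_def using h by simp
  have g: "0 < \<gamma>" using h by simp
  have "c * \<gamma> = \<beta> * (k * \<beta> * \<gamma> + \<delta> * (m * \<gamma>))"
    by (simp add: c_def power2_eq_square algebra_simps)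
  also have "\<dots> = - k * \<beta> * (\<alpha> * \<delta> - \<beta> * \<gamma>)"
  proof -
    have "m * \<gamma> = - (\<alpha> * k)" using h(4) by simp
    then show ?thesis by (simp add: algebra_simps)
  qed
  finally have cg: "c * \<gamma> = - k * \<beta>" using h by simp
  have mg: "m * \<gamma> = - k * \<alpha>" using h(4) by (simp add: algebra_simps)
  have bg: "\<beta> * \<gamma> = \<alpha> * \<delta> - 1" using h(1) by simp
  have mgpos: "0 < m * \<gamma>" using assms g by simp
  have "0 \<le> c \<and> (c = 0 \<or> c \<le> m \<or> 0 < k \<and> k dvd m \<and> c = m + k)"
  proof (cases "0 < k")
    case k: True
    then have a: "\<alpha> < 0" using mg mgpos by (simp add: mult_less_0_iff)
    then have "\<alpha> * \<delta> < 0" using h by (simp add: mult_neg_pos)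
    then have "\<beta> * \<gamma> < 0" using bg by simp
    then have b: "\<beta> < 0" using g by (simp add: mult_less_0_iff)
    then have "0 < c * \<gamma>" unfolding cg using k by (simp add: mult_pos_neg)
    then have c: "0 < c" using g by (simp add: zero_less_mult_iff)
    show ?thesis
    proof (cases "\<delta> = \<gamma>")
      case True
      \<comment> \<open>Equal denominators make the determinant a multiple of \<gamma>, so \<gamma>
        = 1 and the root is the integer \<alpha>: the exceptional case.\<close>
      then have "\<gamma> * (\<alpha> - \<beta>) = 1" using h(1) by (simp add: algebra_simps)
      then have "\<gamma> = 1" "\<alpha> - \<beta> = 1" using g by (auto simp: zmult_eq_1_iff)
      then have "\<alpha> = \<beta> + 1" "m = k * (- \<alpha>)" "c = - k * \<beta>" using mg cg by auto
      then have "c = m + k" "k dvd m" by (simp add: algebra_simps, simp)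
      then show ?thesis using k c by simp
    next
      case False
      then have "1 \<le> \<gamma> - \<delta>" using h by simp
      \<comment> \<open>Distinct denominators gain at least 1, which compensates the 1 from the
        determinant in \<open>bg\<close>.\<close>
      then have "1 * 1 \<le> (- \<alpha>) * (\<gamma> - \<delta>)" using a by (intro mult_mono) auto
      then have "\<alpha> * \<gamma> \<le> \<beta> * \<gamma>" using bg by (simp add: algebra_simps)
      then have "\<alpha> \<le> \<beta>" using g by simp
      then have "c * \<gamma> \<le> m * \<gamma>" unfolding cg mg using k by simp
      then show ?thesis using g c by simp
    qed
  next
    case False
    then have k: "k < 0" using \<open>k \<noteq> 0\<close> by simp
    then have a: "0 < \<alpha>" using mg mgpos by (simp add: zero_less_mult_iff mult_less_0_iff)
    then have "0 < \<alpha> * \<delta>" using h by simp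
    then have "0 \<le> \<beta> * \<gamma>" using bg by simp
    then have b: "0 \<le> \<beta>" using g by (simp add: zero_le_mult_iff)
    \<comment> \<open>Only the weak inequality holds, since \<beta> can be 0; then c = 0, and the
      factor L replaces it by m.\<close>
    then have "0 \<le> c * \<gamma>" unfolding cg using k by (simp add: mult_nonpos_nonneg)
    then have c: "0 \<le> c" using g by (simp add: zero_le_mult_iff)
    have "\<alpha> * \<delta> \<le> \<alpha> * \<gamma>" using a h by simp
    then have "\<beta> * \<gamma> \<le> \<alpha> * \<gamma>" using bg by simp
    then have "\<beta> \<le> \<alpha>" using g by simp
    then have "c * \<gamma> \<le> m * \<gamma>" unfolding cg mg using k by simp
    then show ?thesis using g c by simp
  qed
  then show ?thesis using act_step2_matrix[OF q2] assms by auto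
qed


section \<open>The reduction algorithm\<close>

lemma basic_reduction_eq:
  "basic_reduction q =
    (act (step1 q) (step2_matrix (step1 q)), step1_matrix q ** step2_matrix (step1 q))"
  by (simp add: basic_reduction_def Let_def)

text \<open>In the last case, a \<le> m comes from a dividing m; it ensures that subtracting m from
  the last coefficient leaves a reduced form.\<close>

lemma basic_reduction_cases:
  assumes "disc q = m\<^sup>2" "0 \<le> m"
  obtains (zero) c where "m = 0" "fst (basic_reduction q) = Form 0 0 c"
  | (regular) c where "0 < m" "fst (basic_reduction q) = Form 0 m c" "0 < c" "c \<le> m"
  | (exceptional) a where "0 < a" "a \<le> m" "fst (basic_reduction q) = Form 0 m (m + a)"
      "exceptional q"
proof -
  obtain k where k: "step1 q = Form 0 (- m) k \<or> step1 q = Form k m 0"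
    using step1_cases(2)[OF assms] by blast
  show thesis
  proof (cases "m = 0")
    case True
    then show ?thesis using step2_disc_0[of "step1 q" k] k zero by (simp add: basic_reduction_eq)
  next
    case False
    then have m: "0 < m" using assms by simp
    show ?thesis
    proof (cases "step1 q = Form 0 (- m) k")
      case True
      then show ?thesis
        using step2_first_infinite[OF m, of k] regular m by (auto simp: basic_reduction_eq)
    next
      case False
      then have s: "step1 q = Form k m 0" using k by simp
      obtain c where c: "fst (basic_reduction q) = Form 0 m c" "0 < c"
        "c \<le> m \<or> 0 < k \<and> k dvd m \<and> c = m + k"
        using step2_first_zero[OF m, of k] by (auto simp: basic_reduction_eq s)
      show ?thesis
      proof (cases "c \<le> m")
        case True
        then show ?thesis using regular m c by blast
      next
        case False
        then have "0 < k" "k dvd m" "c = m + k" using c by auto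
        moreover have "k \<le> m" using \<open>k dvd m\<close> m by (rule zdvd_imp_le)
        moreover have "exceptional q" using s m \<open>0 < k\<close> \<open>k dvd m\<close> by (auto simp: exceptional_def)
        ultimately show ?thesis using \<open>fst (basic_reduction q) = _\<close> exceptional by blast
      qed
    qed
  qed
qed

lemma act_basic_reduction: "fst (basic_reduction q) = act q (snd (basic_reduction q))"
  by (simp add: basic_reduction_eq step1_def act_mult)

lemma reduction_eq:
  "reduction q =
    (if \<exists>m c. 0 < m \<and> m < c \<and> fst (basic_reduction q) = Form 0 m c
     then (act (fst (basic_reduction q)) (mat_zpow mat_L (- 1)),
       snd (basic_reduction q) ** mat_zpow mat_L (- 1))
     else basic_reduction q)"
  by (cases "basic_reduction q") (auto simp: reduction_def)

lemma act_reduction: "reduction_form q = act q (reduction_matrix q)"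
  by (simp add: reduction_eq act_basic_reduction act_mult)

lemma det_reduction_matrix:
  assumes "disc q = m\<^sup>2" "0 \<le> m"
  shows "det (reduction_matrix q) = 1"
  using step1_cases(1)[OF assms]
  by (simp add: reduction_eq basic_reduction_eq det_mul det_step2_matrix mat_zpow_L det_mat2)

text \<open>The inverse of L turns [0,m,m+a] into [0,m,a]; the other two cases do not trigger the
  correction.\<close>

lemma reduced_reduction_form:
  assumes "disc q = m\<^sup>2" "0 \<le> m"
  shows "reduced (reduction_form q)"
  using assms
proof (cases rule: basic_reduction_cases)
  case (exceptional a)
  then show ?thesis
    by (auto simp: reduction_eq mat_zpow_L act_mat2 reduced_def disc_def)
qed (auto simp: reduction_eq reduced_def disc_def)

lemma reduction_eq_basic_reduction:
  assumes "disc q = m\<^sup>2" "0 \<le> m" "\<not> exceptional q"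
  shows "reduction q = basic_reduction q"
  using assms(1,2)
  by (cases rule: basic_reduction_cases) (use assms(3) in \<open>auto simp: reduction_eq\<close>)

text \<open>The conjunct on \<open>exceptional\<close> confines the final correction to the
  exceptional forms. The discriminants of the two forms may differ; each side of the equivalence
  forces them to agree.\<close>

theorem theorem6p9:
  fixes q q' :: form and m m' :: int
  assumes "q \<noteq> Form 0 0 0" "0 \<le> m" "disc q = m\<^sup>2"
    and "q' \<noteq> Form 0 0 0" "0 \<le> m'" "disc q' = m'\<^sup>2"
  shows "reduced (reduction_form q)
    \<and> det (reduction_matrix q) = 1
    \<and> reduction_form q = act q (reduction_matrix q)
    \<and> (\<not> exceptional q \<longrightarrow> reduction q = basic_reduction q)
    \<and> (equivalent q q' \<longleftrightarrow> reduction_form q = reduction_form q')"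
proof -
  have e: "equivalent (reduction_form q) q" "equivalent (reduction_form q') q'"
    using det_reduction_matrix assms by (auto simp: act_reduction intro!: equivalent_act)
  have r: "reduced (reduction_form q)" "reduced (reduction_form q')"
    using reduced_reduction_form assms by blast+
  have "equivalent q q' \<longleftrightarrow> reduction_form q = reduction_form q'"
  proof
    assume "equivalent q q'"
    then have "equivalent (reduction_form q) (reduction_form q')"
      using e equivalent_sym equivalent_trans by blast
    then show "reduction_form q = reduction_form q'" using r by (rule equivalent_reduced_eq)
  next
    assume "reduction_form q = reduction_form q'"
    then show "equivalent q q'" using e equivalent_sym equivalent_trans by metis
  qed
  then show ?thesis
    using r act_reduction det_reduction_matrix reduction_eq_basic_reduction assms by blast
qed

end
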